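(* Let $A\in\mathbb{R}^{m\times n}$, $B\in\mathbb{R}^{s\times n}$, $b\in\mathbb{R}^m$, $d\in\mathbb{R}^s$ with $\mathrm{rank}(B)=s$ and $A^TJA$ positive definite, where $J=\mathrm{diag}(I_p,-I_q)$, $p+q=m$. Let $x$ be the unique solution of the EILS problem $\min_{x\in\mathbb{R}^n}(b-Ax)^TJ(b-Ax)$ subject to $Bx=d$. Let $L\in\mathbb{R}^{n\times k}$ with $\mathrm{rank}(L)=k$, let $\xi_L\in\mathbb{R}^k$ (or a positive real number), and let $\Phi\in\mathbb{R}^{m\times n}$, $\Psi\in\mathbb{R}^{s\times n}$, $\beta\in\mathbb{R}^m$, $\vartheta\in\mathbb{R}^s$ have only nonzero entries. Then the projected condition number of the EILS problem with the max norm on the data space and the $\infty$-norm on $\mathbb{R}^k$ (defined in the context) is $$\kappa_{\infty L\mathcal{F}}(A,B,b,d)=\left\|\xi_L\circ\left(L^T\mathcal{M}_{\mathcal{F}}\,\mathrm{diag}(\mathrm{vec}(\Phi,\Psi,\beta,\vartheta)^{\ddagger})\right)\right\|_\infty=\left\||\xi_L|\circ\left(|L^T\mathcal{M}_{\mathcal{F}}|\,|\mathrm{vec}(\Phi,\Psi,\beta,\vartheta)^{\ddagger}|\right)\right\|_\infty,$$ where $$\mathcal{M}_{\mathcal{F}}=\begin{bmatrix}\Gamma, & -\Omega, & -P^TM^{-1}A^TJ, & M^{-1}B^TN^{-1}\end{bmatrix},$$ $\Gamma=x^T\otimes(P^TM^{-1}A^TJ)-(M^{-1}P)\otimes(Jr)^T$,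 $\Omega=(M^{-1}P)\otimes\lambda^T+x^T\otimes(M^{-1}B^TN^{-1})$, $M=A^TJA$, $N=BM^{-1}B^T$, $P=B^TN^{-1}BM^{-1}-I_n$, $r=b-Ax$, $\lambda=-(BB^T)^{-1}BA^TJr$. In particular, for $\Phi=A^{\ddagger}$, $\Psi=B^{\ddagger}$, $\beta=b^{\ddagger}$, $\vartheta=d^{\ddagger}$: taking $\xi_L=1/\|L^Tx\|_\infty$ (with $L^Tx\ne0$), the resulting projected mixed condition number is $$\kappa^m_{\infty L\mathcal{F}}(A,B,b,d)=\frac{\left\||L^T\mathcal{M}_{\mathcal{F}}|\,|\mathrm{vec}(A^{\ddagger},B^{\ddagger},b^{\ddagger},d^{\ddagger})^{\ddagger}|\right\|_\infty}{\|L^Tx\|_\infty},$$ and taking $\xi_L=(L^Tx)^{\ddagger}$, the resulting projected componentwise condition number is $$\kappa^c_{\infty L\mathcal{F}}(A,B,b,d)=\left\|\frac{|L^T\mathcal{M}_{\mathcal{F}}|\,|\mathrm{vec}(A^{\ddagger},B^{\ddagger},b^{\ddagger},d^{\ddagger})^{\ddagger}|}{|L^Tx|}\right\|_\infty.$$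
   Context: Notation: $\mathrm{vec}(A)$ stacks the columns of $A$; $\mathrm{vec}(A,B,b,d)=[\mathrm{vec}(A)^T,\mathrm{vec}(B)^T,b^T,d^T]^T$; $\otimes$ is the Kronecker product $X\otimes Y=[x_{ij}Y]$; $\circ$ is the Hadamard product; for a vector $\xi\in\mathbb{R}^k$ and a matrix $X$ with $k$ rows, $\xi\circ X:=\mathrm{diag}(\xi)X$, and for a scalar $\xi$, $\xi\circ X:=\xi X$. Absolute values of vectors and matrices are entrywise. For a real number $c$, $c^{\ddagger}=1/c$ if $c\neq0$ and $c^{\ddagger}=1$ if $c=0$; $\ddagger$ is applied entrywise to vectors and matrices. (Thus $(c^{\ddagger})^{\ddagger}=c$ if $c\ne 0$ and $(0^{\ddagger})^{\ddagger}=1$.) Entrywise division of vectors is $\frac{a}{b}:=\mathrm{diag}(b^{\ddagger})a$. $\|\cdot\|_\infty$ is the max norm on vectors and the induced (maximum absolute row sum) norm on matrices; $\|\cdot\|_{\max}$ is the maximum absolute value of all entries. The solution map near the given data is $\mathcal{F}(A,B,b,d)=x=M^{-1}B^TN^{-1}d-P^TM^{-1}A^TJb$, the unique solution of the EILS problem; $\mathcal{F}_L=L^T\mathcal{F}$. The condition number is $$\kappa_{\infty L\mathcal{F}}(A,B,b,d)=\lim_{\delta\to0^+}\ \sup_{0<\|\rho\circ\Delta\|_{\max}\le\delta}\frac{\|\xi_L\circ(\mathcal{F}_L(A+\Delta A,B+\Delta B,b+\Delta b,d+\Delta d)-\mathcal{F}_L(A,B,b,d))\|_\infty}{\|\rho\circ\Delta\|_{\max}},$$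 where $\rho\circ\Delta=(\Phi\circ\Delta A,\Psi\circ\Delta B,\beta\circ\Delta b,\vartheta\circ\Delta d)$ and $\|\rho\circ\Delta\|_{\max}$ is the largest absolute value of an entry of any of these four blocks. *)

theory Defs
  imports "HOL-Analysis.Analysis"
begin

section \<open>Matrix notation\<close>

text \<open>
  On \<^typ>\<open>real^'n\<close> and \<^typ>\<open>real^'n^'m\<close> the library operations \<^term>\<open>(*)\<close> and \<^term>\<open>abs\<close> act
  entrywise, so \<^term>\<open>(*)\<close> is the Hadamard product. \<^const>\<open>infnorm\<close> is the largest absolute value
  of a coordinate; this applies to vectors, to matrices and to tuples of such objects
  (see \<open>infnorm_Pair\<close> and \<open>infnorm_matrix\<close> below).
\<close>

definition ddag :: "real \<Rightarrow> real"
  where "ddag c = (if c = 0 then 1 else 1 / c)"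

definition ddag_vec :: "real^'n \<Rightarrow> real^'n"
  where "ddag_vec v = (\<chi> i. ddag (v $ i))"

definition ddag_mat :: "real^'n^'m \<Rightarrow> real^'n^'m"
  where "ddag_mat A = (\<chi> i j. ddag (A $ i $ j))"

definition diag_mat :: "real^'n \<Rightarrow> real^'n^'n"
  where "diag_mat v = (\<chi> i j. if i = j then v $ i else 0)"

definition vec_divide :: "real^'n \<Rightarrow> real^'n \<Rightarrow> real^'n"
  where "vec_divide a b = diag_mat (ddag_vec b) *v a"

definition mat_infnorm :: "real^'n^'m \<Rightarrow> real"
  where "mat_infnorm A = Max (range (\<lambda>i. \<Sum>j\<in>UNIV. \<bar>A $ i $ j\<bar>))"

definition positive_definite :: "real^'n^'n \<Rightarrow> bool"
  where "positive_definite A \<longleftrightarrow> transpose A = A \<and> (\<forall>v. v \<noteq> 0 \<longrightarrow> 0 < v \<bullet> (A *v v))"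

text \<open>
  Rows and columns of a Kronecker product are indexed by pairs, the index of the first factor being
  the more significant one.
\<close>

definition kron :: "real^'b^'a \<Rightarrow> real^'d^'c \<Rightarrow> real^('b \<times> 'd)^('a \<times> 'c)"
  where "kron X Y = (\<chi> i j. X $ fst i $ fst j * Y $ snd i $ snd j)"

text \<open>
  \<open>x\<^sup>T \<otimes> Y\<close> and \<open>X \<otimes> y\<^sup>T\<close>. The row index types \<open>1 \<times> 'c\<close> and \<open>'a \<times> 1\<close> of these Kronecker products
  are identified with \<open>'c\<close> and \<open>'a\<close>.
\<close>

definition kron_row_left :: "real^'b \<Rightarrow> real^'d^'c \<Rightarrow> real^('b \<times> 'd)^'c"
  where "kron_row_left x Y = (\<chi> i. kron (rowvector x :: real^'b^1) Y $ (1, i))"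

definition kron_row_right :: "real^'b^'a \<Rightarrow> real^'d \<Rightarrow> real^('b \<times> 'd)^'a"
  where "kron_row_right X y = (\<chi> i. kron X (rowvector y :: real^'d^1) $ (i, 1))"

text \<open>
  Column stacking. The position of the entry \<^term>\<open>A $ i $ j\<close> is \<^term>\<open>(j, i)\<close>, with the column
  index first, so that it matches the column indices of \<^const>\<open>kron\<close>.
\<close>

definition vec_of_mat :: "real^'n^'m \<Rightarrow> real^('n \<times> 'm)"
  where "vec_of_mat A = (\<chi> k. A $ snd k $ fst k)"

definition append_vec :: "real^'a \<Rightarrow> real^'b \<Rightarrow> real^('a + 'b)"
  where "append_vec u v = (\<chi> k. case k of Inl i \<Rightarrow> u $ i | Inr j \<Rightarrow> v $ j)"

definition append_cols :: "real^'a^'m \<Rightarrow> real^'b^'m \<Rightarrow> real^('a + 'b)^'m"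
  where "append_cols X Y = (\<chi> i. append_vec (X $ i) (Y $ i))"

definition vec_data ::
    "real^'n^'m \<Rightarrow> real^'n^'s \<Rightarrow> real^'m \<Rightarrow> real^'s \<Rightarrow> real^('n \<times> 'm + ('n \<times> 's + ('m + 's)))"
  where "vec_data A B b d =
    append_vec (vec_of_mat A) (append_vec (vec_of_mat B) (append_vec b d))"


section \<open>The EILS problem\<close>

text \<open>
  \<open>diag(I\<^sub>p, -I\<^sub>q)\<close>, where \<open>p + q\<close> is the size of the matrix: the first \<open>p\<close> indices, in the order of
  the index type, carry the sign \<open>+1\<close>.
\<close>

definition sig_mat :: "nat \<Rightarrow> ((real, 'm) vec, 'm::{finite,linorder}) vec"
  where "sig_mat p = (\<chi> i j. if i = j then (if card {l. l < i} < p then 1 else - 1) else 0)"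

definition eils_obj :: "nat \<Rightarrow> real^'n^('m::{finite,linorder}) \<Rightarrow> (real, 'm) vec \<Rightarrow> real^'n \<Rightarrow> real"
  where "eils_obj p A b y = (b - A *v y) \<bullet> (sig_mat p *v (b - A *v y))"

definition is_eils_sol ::
    "nat \<Rightarrow> real^'n^('m::{finite,linorder}) \<Rightarrow> real^'n^'s \<Rightarrow> (real, 'm) vec \<Rightarrow> real^'s \<Rightarrow> real^'n \<Rightarrow> bool"
  where "is_eils_sol p A B b d y \<longleftrightarrow> is_arg_min (eils_obj p A b) (\<lambda>y. B *v y = d) y"

text \<open>
  The solution map is meaningful only where the minimizer exists and is unique, which is the case
  in a neighbourhood of the data considered; the closed form is proved in \<open>eils_sol_eq\<close> below.
\<close>

definition eils_sol ::
    "nat \<Rightarrow> real^'n^('m::{finite,linorder}) \<Rightarrow> real^'n^'s \<Rightarrow> (real, 'm) vec \<Rightarrow> real^'s \<Rightarrow> real^'n"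
  where "eils_sol p A B b d = (THE y. is_eils_sol p A B b d y)"

definition eils_M :: "nat \<Rightarrow> real^'n^('m::{finite,linorder}) \<Rightarrow> real^'n^'n"
  where "eils_M p A = transpose A ** sig_mat p ** A"

definition eils_N :: "nat \<Rightarrow> real^'n^('m::{finite,linorder}) \<Rightarrow> real^'n^'s \<Rightarrow> real^'s^'s"
  where "eils_N p A B = B ** matrix_inv (eils_M p A) ** transpose B"

definition eils_P :: "nat \<Rightarrow> real^'n^('m::{finite,linorder}) \<Rightarrow> real^'n^'s \<Rightarrow> real^'n^'n"
  where "eils_P p A B =
    transpose B ** matrix_inv (eils_N p A B) ** B ** matrix_inv (eils_M p A) - mat 1"

definition eils_res :: "real^'n^('m::{finite,linorder}) \<Rightarrow> (real, 'm) vec \<Rightarrow> real^'n \<Rightarrow> (real, 'm) vec"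
  where "eils_res A b x = b - A *v x"

definition eils_mult ::
    "nat \<Rightarrow> real^'n^('m::{finite,linorder}) \<Rightarrow> real^'n^'s \<Rightarrow> (real, 'm) vec \<Rightarrow> real^'n \<Rightarrow> real^'s"
  where "eils_mult p A B b x =
    - ((matrix_inv (B ** transpose B) ** B ** transpose A ** sig_mat p) *v eils_res A b x)"

text \<open>Up to the sign of the first, the coefficient matrices \<open>P\<^sup>TM\<^sup>-\<^sup>1A\<^sup>TJ\<close> and \<open>M\<^sup>-\<^sup>1B\<^sup>TN\<^sup>-\<^sup>1\<close> of \<open>b\<close> and \<open>d\<close>.\<close>

definition eils_bcoef :: "nat \<Rightarrow> real^'n^('m::{finite,linorder}) \<Rightarrow> real^'n^'s \<Rightarrow> (real, 'm) vec^'n"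
  where "eils_bcoef p A B =
    transpose (eils_P p A B) ** matrix_inv (eils_M p A) ** transpose A ** sig_mat p"

definition eils_dcoef :: "nat \<Rightarrow> real^'n^('m::{finite,linorder}) \<Rightarrow> real^'n^'s \<Rightarrow> real^'s^'n"
  where "eils_dcoef p A B =
    matrix_inv (eils_M p A) ** transpose B ** matrix_inv (eils_N p A B)"

definition eils_Gamma ::
    "nat \<Rightarrow> real^'n^('m::{finite,linorder}) \<Rightarrow> real^'n^'s \<Rightarrow> (real, 'm) vec \<Rightarrow> real^'n \<Rightarrow> real^('n \<times> 'm)^'n"
  where "eils_Gamma p A B b x =
    kron_row_left x (eils_bcoef p A B)
    - kron_row_right (matrix_inv (eils_M p A) ** eils_P p A B) (sig_mat p *v eils_res A b x)"

definition eils_Omega ::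
    "nat \<Rightarrow> real^'n^('m::{finite,linorder}) \<Rightarrow> real^'n^'s \<Rightarrow> (real, 'm) vec \<Rightarrow> real^'n \<Rightarrow> real^('n \<times> 's)^'n"
  where "eils_Omega p A B b x =
    kron_row_right (matrix_inv (eils_M p A) ** eils_P p A B) (eils_mult p A B b x)
    + kron_row_left x (eils_dcoef p A B)"

definition eils_MF ::
    "nat \<Rightarrow> real^'n^('m::{finite,linorder}) \<Rightarrow> real^'n^'s \<Rightarrow> (real, 'm) vec \<Rightarrow> real^'n
      \<Rightarrow> real^('n \<times> 'm + ('n \<times> 's + ('m + 's)))^'n"
  where "eils_MF p A B b x =
    append_cols (eils_Gamma p A B b x)
      (append_cols (- eils_Omega p A B b x)
        (append_cols (- eils_bcoef p A B) (eils_dcoef p A B)))"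


section \<open>The projected condition number\<close>

text \<open>The output weight is either a vector or a single real number.\<close>

datatype 'k weight = Vec_Weight "real^'k" | Scalar_Weight real

fun admissible_weight :: "('k::finite) weight \<Rightarrow> bool" where
  "admissible_weight (Vec_Weight w) \<longleftrightarrow> True"
| "admissible_weight (Scalar_Weight c) \<longleftrightarrow> c > 0"

fun abs_weight :: "('k::finite) weight \<Rightarrow> 'k weight" where
  "abs_weight (Vec_Weight w) = Vec_Weight \<bar>w\<bar>"
| "abs_weight (Scalar_Weight c) = Scalar_Weight \<bar>c\<bar>"

fun weight_vec :: "('k::finite) weight \<Rightarrow> real^'k \<Rightarrow> real^'k" where
  "weight_vec (Vec_Weight w) v = diag_mat w *v v"
| "weight_vec (Scalar_Weight c) v = c *\<^sub>R v"

fun weight_mat :: "('k::finite) weight \<Rightarrow> real^'j^'k \<Rightarrow> real^'j^'k" where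
  "weight_mat (Vec_Weight w) X = diag_mat w ** X"
| "weight_mat (Scalar_Weight c) X = c *\<^sub>R X"

definition proj_sol ::
    "nat \<Rightarrow> real^'k^'n \<Rightarrow> real^'n^('m::{finite,linorder}) \<Rightarrow> real^'n^'s \<Rightarrow> (real, 'm) vec \<Rightarrow> real^'s \<Rightarrow> real^'k"
  where "proj_sol p L A B b d = transpose L *v eils_sol p A B b d"

text \<open>
  The supremum is taken in the extended reals. It is nondecreasing in \<open>\<delta>\<close>, so the limit exists.
\<close>

definition proj_cond ::
    "nat \<Rightarrow> real^'k^'n \<Rightarrow> 'k weight
      \<Rightarrow> (real^'n, 'm) vec \<Rightarrow> real^'n^'s \<Rightarrow> (real, 'm) vec \<Rightarrow> real^'s
      \<Rightarrow> real^'n^('m::{finite,linorder}) \<Rightarrow> real^'n^'s \<Rightarrow> (real, 'm) vec \<Rightarrow> real^'s \<Rightarrow> ereal"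
  where "proj_cond p L \<xi> \<Phi> \<Psi> \<beta> \<theta> A B b d =
    Lim (at_right (0::real)) (\<lambda>\<delta>.
      Sup {ereal (infnorm (weight_vec \<xi> (proj_sol p L (A + dA) (B + dB) (b + db) (d + dd)
                                          - proj_sol p L A B b d))
                  / infnorm (\<Phi> * dA, \<Psi> * dB, \<beta> * db, \<theta> * dd)) | dA dB db dd.
           0 < infnorm (\<Phi> * dA, \<Psi> * dB, \<beta> * db, \<theta> * dd)
           \<and> infnorm (\<Phi> * dA, \<Psi> * dB, \<beta> * db, \<theta> * dd) \<le> \<delta>})"

definition proj_mixed_cond ::
    "nat \<Rightarrow> real^'k^'n \<Rightarrow> real^'n^('m::{finite,linorder}) \<Rightarrow> real^'n^'s \<Rightarrow> (real, 'm) vec \<Rightarrow> real^'s \<Rightarrow> ereal"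
  where "proj_mixed_cond p L A B b d =
    proj_cond p L (Scalar_Weight (1 / infnorm (proj_sol p L A B b d)))
      (ddag_mat A) (ddag_mat B) (ddag_vec b) (ddag_vec d) A B b d"

definition proj_comp_cond ::
    "nat \<Rightarrow> real^'k^'n \<Rightarrow> real^'n^('m::{finite,linorder}) \<Rightarrow> real^'n^'s \<Rightarrow> (real, 'm) vec \<Rightarrow> real^'s \<Rightarrow> ereal"
  where "proj_comp_cond p L A B b d =
    proj_cond p L (Vec_Weight (ddag_vec (proj_sol p L A B b d)))
      (ddag_mat A) (ddag_mat B) (ddag_vec b) (ddag_vec d) A B b d"


section \<open>Sanity lemmas\<close>

lemma infnorm_Pair:
  fixes x :: "'a::euclidean_space" and y :: "'b::euclidean_space"
  shows "infnorm (x, y) = max (infnorm x) (infnorm y)"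
proof -
  have "(\<lambda>i. \<bar>(x, y) \<bullet> i\<bar>) ` Basis = (\<lambda>i. \<bar>x \<bullet> i\<bar>) ` Basis \<union> (\<lambda>i. \<bar>y \<bullet> i\<bar>) ` Basis"
    by (force simp: Basis_prod_def image_Un image_image)
  then show ?thesis
    by (simp add: infnorm_Max Max_Un)
qed

lemma infnorm_matrix:
  fixes A :: "real^'n^'m"
  shows "infnorm A = Max (range (\<lambda>(i, j). \<bar>A $ i $ j\<bar>))"
proof -
  have "(\<lambda>u. \<bar>A \<bullet> u\<bar>) ` Basis = range (\<lambda>(i, j). \<bar>A $ i $ j\<bar>)"
    by (force simp: Basis_vec_def inner_axis)
  then show ?thesis
    by (simp add: infnorm_Max)
qed

lemma matrix_inv_invertible:
  fixes A :: "real^'n^'n"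
  assumes "invertible A"
  shows "A ** matrix_inv A = mat 1" "matrix_inv A ** A = mat 1"
  using assms someI_ex[of "\<lambda>A'. A ** A' = mat 1 \<and> A' ** A = mat 1"]
  unfolding invertible_def matrix_inv_def by blast+

lemma positive_definite_invertible:
  fixes A :: "real^'n^'n"
  assumes "positive_definite A"
  shows "invertible A"
proof -
  have "\<forall>v. A *v v = 0 \<longrightarrow> v = 0"
    using assms unfolding positive_definite_def by (metis inner_zero_right less_irrefl)
  then show ?thesis
    using matrix_left_invertible_ker invertible_left_inverse by blast
qed

lemma symmetric_matrix_inv:
  fixes A :: "real^'n^'n"
  assumes "invertible A" "transpose A = A"
  shows "transpose (matrix_inv A) = matrix_inv A"
proof -
  have "transpose (matrix_inv A) ** A = mat 1"
    using matrix_inv_invertible(1)[OF assms(1)] assms(2)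
    by (metis matrix_transpose_mul transpose_mat)
  then have "transpose (matrix_inv A) ** (A ** matrix_inv A) = matrix_inv A"
    by (simp add: matrix_mul_assoc)
  then show ?thesis
    using matrix_inv_invertible(1)[OF assms(1)] by simp
qed

lemma positive_definite_eils_N:
  fixes A :: "real^'n^('m::{finite,linorder})" and B :: "real^'n^'s"
  assumes "rank B = CARD('s)" "positive_definite (eils_M p A)"
  shows "positive_definite (eils_N p A B)"
proof -
  let ?M = "eils_M p A"
  have inv: "invertible ?M" and sym: "transpose ?M = ?M"
    using assms(2) positive_definite_invertible positive_definite_def by auto
  note MI = matrix_inv_invertible[OF inv] symmetric_matrix_inv[OF inv sym]
  have "inj ((*v) (transpose B))"
    using assms(1) full_rank_injective[of "transpose B"] by (simp add: rank_transpose)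
  have "0 < v \<bullet> (eils_N p A B *v v)" if "v \<noteq> 0" for v
  proof -
    define u where "u = transpose B *v v"
    have "u \<noteq> 0"
      using \<open>inj _\<close> that unfolding u_def by (metis injD matrix_vector_mult_0_right)
    define w where "w = matrix_inv ?M *v u"
    have Mw: "?M *v w = u"
      unfolding w_def by (simp add: matrix_vector_mul_assoc MI)
    then have "w \<noteq> 0" using \<open>u \<noteq> 0\<close> by auto
    have "v \<bullet> (eils_N p A B *v v) = v \<bullet> (B *v w)"
      by (simp add: eils_N_def w_def u_def matrix_vector_mul_assoc matrix_mul_assoc
          del: transpose_matrix_vector)
    also have "\<dots> = (transpose B *v v) \<bullet> w"
      by (metis dot_lmul_matrix transpose_matrix_vector)
    also have "\<dots> = w \<bullet> (?M *v w)"
      using Mw by (simp add: u_def inner_commute)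
    finally show ?thesis
      using assms(2) \<open>w \<noteq> 0\<close> by (simp add: positive_definite_def)
  qed
  moreover have "transpose (eils_N p A B) = eils_N p A B"
    by (simp add: eils_N_def matrix_transpose_mul MI matrix_mul_assoc)
  ultimately show ?thesis by (simp add: positive_definite_def)
qed

lemma transpose_sig_mat: "transpose (sig_mat p) = sig_mat p"
  by (auto simp: transpose_def sig_mat_def vec_eq_iff)

lemma is_eils_sol_iff:
  fixes A :: "real^'n^('m::{finite,linorder})" and B :: "real^'n^'s"
  assumes "rank B = CARD('s)" "positive_definite (eils_M p A)"
  shows "is_eils_sol p A B b d y \<longleftrightarrow> y = eils_dcoef p A B *v d - eils_bcoef p A B *v b"
proof -
  let ?M = "eils_M p A" and ?N = "eils_N p A B" and ?J = "sig_mat p :: ((real, 'm) vec, 'm) vec"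
  let ?x = "eils_dcoef p A B *v d - eils_bcoef p A B *v b"
  have inv: "invertible ?M" and sym: "transpose ?M = ?M"
    using assms(2) positive_definite_invertible positive_definite_def by auto
  have invN: "invertible ?N" and symN: "transpose ?N = ?N"
    using positive_definite_eils_N[OF assms] positive_definite_invertible positive_definite_def
    by auto
  note MI = matrix_inv_invertible[OF inv] symmetric_matrix_inv[OF inv sym]
  note NI = matrix_inv_invertible[OF invN] symmetric_matrix_inv[OF invN symN]
  define c where "c = transpose A *v (?J *v b)"
  define z where "z = matrix_inv ?N *v (d - B *v (matrix_inv ?M *v c))"
  have PT: "transpose (eils_P p A B) = matrix_inv ?M ** transpose B ** matrix_inv ?N ** B - mat 1"
  proof -
    have "transpose (X - mat 1) = transpose X - mat 1" for X :: "real^'n^'n"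
      by (simp add: transpose_def vec_eq_iff mat_def)
    then show ?thesis
      by (simp add: eils_P_def matrix_transpose_mul MI NI matrix_mul_assoc)
  qed
  have x: "?x = matrix_inv ?M *v (transpose B *v z + c)"
    by (simp add: z_def c_def eils_bcoef_def eils_dcoef_def PT matrix_vector_mul_assoc[symmetric]
        matrix_vector_mult_diff_distrib matrix_vector_right_distrib matrix_vector_mult_diff_rdistrib)
  have Mx: "?M *v ?x = transpose B *v z + c"
    unfolding x by (simp add: matrix_vector_mul_assoc MI)
  have "B *v ?x = ?N *v z + B *v (matrix_inv ?M *v c)"
    unfolding x by (simp add: eils_N_def matrix_vector_mul_assoc[symmetric] matrix_vector_right_distrib)
  also have "?N *v z = d - B *v (matrix_inv ?M *v c)"
    unfolding z_def by (simp only: matrix_vector_mul_assoc NI matrix_vector_mul_lid)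
  finally have Bx: "B *v ?x = d" by simp
  have adj: "u \<bullet> (X *v v) = (transpose X *v u) \<bullet> v" for X :: "real^'j^'i" and u v
    by (metis dot_lmul_matrix transpose_matrix_vector)
  have key: "eils_obj p A b y = eils_obj p A b ?x + (y - ?x) \<bullet> (?M *v (y - ?x))"
    if "B *v y = d" for y
  proof -
    define h where "h = y - ?x"
    define r where "r = b - A *v ?x"
    have Bh: "B *v h = 0"
      using that Bx by (simp add: h_def matrix_vector_mult_diff_distrib)
    have ry: "b - A *v y = r - A *v h"
      by (simp add: h_def r_def matrix_vector_mult_diff_distrib)
    have "h \<bullet> (transpose A *v (?J *v r)) = h \<bullet> (c - ?M *v ?x)"
      by (simp only: r_def c_def eils_M_def matrix_vector_mult_diff_distrib matrix_vector_mul_assoc[symmetric])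
    also have "\<dots> = - (h \<bullet> (transpose B *v z))"
      by (simp only: Mx) (simp add: inner_diff_right inner_add_right)
    also have "\<dots> = 0"
      using Bh by (simp add: adj del: transpose_matrix_vector)
    finally have 0: "h \<bullet> (transpose A *v (?J *v r)) = 0" .
    have 1: "(A *v h) \<bullet> (?J *v r) = 0"
      using 0 adj[of h "transpose A"] by (simp del: transpose_matrix_vector)
    have 2: "r \<bullet> (?J *v (A *v h)) = 0"
      using 1 by (metis adj inner_commute transpose_sig_mat)
    have 3: "(A *v h) \<bullet> (?J *v (A *v h)) = h \<bullet> (?M *v h)"
      using adj[of h "transpose A"]
      by (simp add: eils_M_def matrix_vector_mul_assoc[symmetric] del: transpose_matrix_vector)
    show ?thesis
      unfolding eils_obj_def ry r_def[symmetric] h_def[symmetric]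
      using 1 2 3 by (simp add: matrix_vector_mult_diff_distrib inner_diff_left inner_diff_right)
  qed
  have pos: "0 < v \<bullet> (?M *v v)" if "v \<noteq> 0" for v
    using assms(2) that by (simp add: positive_definite_def)
  show ?thesis
  proof
    assume "is_eils_sol p A B b d y"
    then have "B *v y = d" "\<not> eils_obj p A b ?x < eils_obj p A b y"
      using Bx by (auto simp: is_eils_sol_def is_arg_min_def)
    then show "y = ?x"
      using key[of y] pos[of "y - ?x"] by auto
  next
    have "0 \<le> v \<bullet> (?M *v v)" for v
      using pos[of v] by (cases "v = 0") auto
    then have "\<not> eils_obj p A b v < eils_obj p A b ?x" if "B *v v = d" for v
      using key[OF that] by (smt (verit))
    moreover assume "y = ?x"
    ultimately show "is_eils_sol p A B b d y"
      using Bx unfolding is_eils_sol_def is_arg_min_def by blast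
  qed
qed

lemma eils_sol_eq:
  fixes A :: "real^'n^('m::{finite,linorder})" and B :: "real^'n^'s"
  assumes "rank B = CARD('s)" "positive_definite (transpose A ** sig_mat p ** A)"
  shows "eils_sol p A B b d =
    (matrix_inv (eils_M p A) ** transpose B ** matrix_inv (eils_N p A B)) *v d
    - (transpose (eils_P p A B) ** matrix_inv (eils_M p A) ** transpose A ** sig_mat p) *v b"
  using assms
  by (simp add: eils_sol_def is_eils_sol_iff eils_M_def[symmetric] eils_dcoef_def eils_bcoef_def)

end

theory Submission
  imports Defs
begin

text \<open>
  With the multiplier \<open>\<lambda>\<close> and the residual \<open>r = b - Ax\<close>, the EILS problem is the linear system
  \<open>A\<^sup>TJr + B\<^sup>T\<lambda> = 0\<close>, \<open>Bx = d\<close>, \<open>Ax + r = b\<close>. Its operator \<open>K\<close> is injective, and a change \<open>\<Delta>\<close> of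
  the data adds to \<open>K\<close> a term bilinear in \<open>\<Delta>\<close> and \<open>w = (x, \<lambda>, r)\<close>. Subtracting the two systems
  therefore shows first that \<open>w\<close> moves by \<open>O(|\<Delta>|)\<close>, and then that \<open>x\<close> moves by
  \<open>\<M>\<^sub>F vec(\<Delta>) + O(|\<Delta>|\<^sup>2)\<close>; no derivative of a matrix inverse is needed. The condition number is then
  the \<open>\<infinity>\<close>-operator norm of the weighted linear part, because the supremum for a given \<open>\<delta>\<close> differs
  from that norm by \<open>O(\<delta>)\<close>.
\<close>

declare transpose_matrix_vector [simp del]

section \<open>Stability of the rank and definiteness conditions\<close>

lemma adjoint_matrix: "(X *v u) \<bullet> v = u \<bullet> (transpose X *v v)" for X :: "real^'j^'i"
  by (metis dot_lmul_matrix inner_commute transpose_matrix_vector)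

lemma transpose_add: "transpose (X + Y) = transpose X + transpose Y"
  by (simp add: transpose_def vec_eq_iff)

lemma bounded_bilinear_matrix_vector_mult:
  "bounded_bilinear ((*v) :: real^'n^'m \<Rightarrow> real^'n \<Rightarrow> real^'m)"
  unfolding bilinear_conv_bounded_bilinear[symmetric] bilinear_def
  by (auto intro!: linearI simp: matrix_vector_mult_add_rdistrib matrix_vector_right_distrib
      matrix_vector_mult_scaleR scaleR_matrix_vector_assoc[symmetric])

lemma bounded_bilinear_matrix_matrix_mult:
  "bounded_bilinear ((**) :: real^'n^'m \<Rightarrow> real^'k^'n \<Rightarrow> real^'k^'m)"
  unfolding bilinear_conv_bounded_bilinear[symmetric] bilinear_def
  by (auto intro!: linearI simp: matrix_matrix_mult_def vec_eq_iff sum.distrib sum_distrib_left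
      algebra_simps)

lemma bounded_linear_transpose: "bounded_linear (transpose :: real^'n^'m \<Rightarrow> real^'m^'n)"
  by (intro linear_conv_bounded_linear[THEN iffD1] linearI) (simp_all add: transpose_add transpose_scalar)

text \<open>On the compact unit sphere the quadratic form attains its minimum, which is positive;
  homogeneity of degree two carries the bound to all vectors.\<close>

lemma positive_definite_coercive:
  fixes M :: "real^'n^'n"
  assumes "positive_definite M"
  obtains c where "c > 0" "\<And>v. c * (norm v)\<^sup>2 \<le> v \<bullet> (M *v v)"
proof -
  obtain u :: "real^'n" where u: "u \<in> sphere 0 1"
      and min: "\<And>v. v \<in> sphere 0 1 \<Longrightarrow> u \<bullet> (M *v u) \<le> v \<bullet> (M *v v)"
  proof -
    have "axis undefined 1 \<in> sphere (0::real^'n) 1" by (simp add: norm_axis_1)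
    moreover have "continuous_on (sphere 0 1) (\<lambda>v::real^'n. v \<bullet> (M *v v))"
      by (intro continuous_intros matrix_vector_mult_linear_continuous_on)
    ultimately show thesis
      using that continuous_attains_inf[OF compact_sphere, of "0::real^'n" 1] by blast
  qed
  define c where "c = u \<bullet> (M *v u)"
  have "u \<noteq> 0" using u by auto
  then have "c > 0" using assms by (simp add: c_def positive_definite_def)
  moreover have "c * (norm v)\<^sup>2 \<le> v \<bullet> (M *v v)" for v
  proof (cases "v = 0")
    case False
    define w where "w = (1 / norm v) *\<^sub>R v"
    have w: "w \<in> sphere 0 1" and v: "v = norm v *\<^sub>R w"
      using False by (auto simp: w_def)
    have "v \<bullet> (M *v v) = (norm v)\<^sup>2 * (w \<bullet> (M *v w))"
      by (subst (1 2) v) (simp add: matrix_vector_mult_scaleR power2_eq_square)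
    then show ?thesis
      using min[OF w] by (simp add: c_def mult.commute[of _ "(norm v)\<^sup>2"] mult_left_mono)
  qed simp
  ultimately show thesis by (rule that)
qed

text \<open>With coercivity constant \<open>c\<close> and a bound \<open>K\<close> for the
  matrix-vector product, a change of \<open>eils_M p A\<close> of norm below \<open>c / K\<close>
  alters the form at nonzero \<open>v\<close> by less than \<open>c * (norm v)\<^sup>2\<close>, so
  it stays positive.\<close>

lemma eventually_positive_definite_eils_M:
  fixes A :: "real^'n^('m::{finite,linorder})"
  assumes "positive_definite (eils_M p A)"
  shows "\<forall>\<^sub>F A' in nhds A. positive_definite (eils_M p A')"
proof -
  obtain c where c: "c > 0" "\<And>v. c * (norm v)\<^sup>2 \<le> v \<bullet> (eils_M p A *v v)"
    using positive_definite_coercive[OF assms] by blast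
  interpret mv: bounded_bilinear "(*v) :: real^'n^'n \<Rightarrow> real^'n \<Rightarrow> real^'n"
    by (rule bounded_bilinear_matrix_vector_mult)
  obtain K where K: "K > 0" "\<And>(X::real^'n^'n) v. norm (X *v v) \<le> norm X * norm v * K"
    using mv.pos_bounded by blast
  note tr = bounded_linear.tendsto[OF bounded_linear_transpose]
  note mm = bounded_bilinear.tendsto[OF bounded_bilinear_matrix_matrix_mult]
  have "(eils_M p \<longlongrightarrow> eils_M p A) (nhds A)"
    unfolding eils_M_def by (intro mm tr tendsto_const tendsto_ident_at filterlim_ident)
  then have "\<forall>\<^sub>F A' in nhds A. dist (eils_M p A') (eils_M p A) < c / K"
    by (rule tendstoD) (use c(1) K(1) in simp)
  then show ?thesis
  proof eventually_elim
    case (elim A')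
    define D where "D = eils_M p A' - eils_M p A"
    have "0 < v \<bullet> (eils_M p A' *v v)" if "v \<noteq> 0" for v
    proof -
      have "\<bar>v \<bullet> (D *v v)\<bar> \<le> norm v * (norm D * norm v * K)"
        by (rule order_trans[OF Cauchy_Schwarz_ineq2]) (intro mult_left_mono K(2) norm_ge_zero)
      also have "\<dots> = (norm D * K) * (norm v)\<^sup>2"
        by (simp add: power2_eq_square)
      also have "\<dots> < c * (norm v)\<^sup>2"
        using elim K(1) that by (simp add: D_def dist_norm field_simps)
      finally have "- (v \<bullet> (D *v v)) < v \<bullet> (eils_M p A *v v)"
        using c(2)[of v] by linarith
      then show ?thesis
        by (simp add: D_def matrix_vector_mult_diff_rdistrib inner_diff_right)
    qed
    moreover have "transpose (eils_M p A') = eils_M p A'"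
      by (simp add: eils_M_def matrix_transpose_mul transpose_sig_mat matrix_mul_assoc)
    ultimately show ?case
      by (simp add: positive_definite_def)
  qed
qed

text \<open>Full row rank is injectivity of the transpose, hence a lower bound with some
  \<open>c > 0\<close>; a perturbation of norm below \<open>c / K\<close> cannot bring this down to
  zero.\<close>

lemma eventually_full_row_rank:
  fixes B :: "real^'n^'s"
  assumes "rank B = CARD('s)"
  shows "\<forall>\<^sub>F B' in nhds B. rank B' = CARD('s)"
proof -
  have inj_iff: "rank X = CARD('s) \<longleftrightarrow> inj ((*v) (transpose X))" for X :: "real^'n^'s"
    using full_rank_injective[of "transpose X"] by (simp add: rank_transpose)
  obtain c where c: "c > 0" "\<And>v. c * norm v \<le> norm (transpose B *v v)"
    using linear_inj_bounded_below_pos[OF matrix_vector_mul_linear iffD1[OF inj_iff assms]] by blast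
  interpret mv: bounded_bilinear "(*v) :: real^'s^'n \<Rightarrow> real^'s \<Rightarrow> real^'n"
    by (rule bounded_bilinear_matrix_vector_mult)
  obtain K where K: "K > 0" "\<And>(X::real^'s^'n) v. norm (X *v v) \<le> norm X * norm v * K"
    using mv.pos_bounded by blast
  have "(transpose \<longlongrightarrow> transpose B) (nhds B)"
    by (intro bounded_linear.tendsto[OF bounded_linear_transpose] filterlim_ident)
  then have "\<forall>\<^sub>F B' in nhds B. dist (transpose B') (transpose B) < c / K"
    by (rule tendstoD) (use c(1) K(1) in simp)
  then show ?thesis
  proof eventually_elim
    case (elim B')
    define D where "D = transpose B' - transpose B"
    have "v = 0" if "transpose B' *v v = 0" for v
    proof (rule ccontr)
      assume "v \<noteq> 0"
      have "transpose B *v v = - (D *v v)"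
        using that by (simp add: D_def matrix_vector_mult_diff_rdistrib)
      then have "c * norm v \<le> norm D * norm v * K"
        using c(2)[of v] K(2)[of D v] by simp
      also have "\<dots> < c * norm v"
        using elim K(1) \<open>v \<noteq> 0\<close> by (simp add: D_def dist_norm field_simps)
      finally show False by simp
    qed
    then have "inj ((*v) (transpose B'))"
      by (intro linear_injective_0[THEN iffD2] matrix_vector_mul_linear) blast
    then show ?case by (simp add: inj_iff)
  qed
qed

section \<open>Stacked data\<close>

lemma sum_UNIV_prod: "(\<Sum>k\<in>UNIV. f k) = (\<Sum>i\<in>UNIV. \<Sum>j\<in>UNIV. f (i, j))"
  for f :: "'i::finite \<times> 'j::finite \<Rightarrow> real"
  by (simp add: sum.cartesian_product flip: UNIV_Times_UNIV)

lemma sum_UNIV_sum: "(\<Sum>k\<in>UNIV. f k) = (\<Sum>i\<in>UNIV. f (Inl i)) + (\<Sum>j\<in>UNIV. f (Inr j))"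
  for f :: "'i::finite + 'j::finite \<Rightarrow> real"
  by (simp add: sum.Plus flip: UNIV_Plus_UNIV)

lemma append_cols_mult_append_vec: "append_cols X Y *v append_vec u v = X *v u + Y *v v"
  by (simp add: vec_eq_iff matrix_vector_mult_def append_cols_def append_vec_def sum_UNIV_sum)

text \<open>The Kronecker-vec identity: both pair indices put the column first, so the two sides
  differ only in the order of summation.\<close>

lemma kron_row_left_mult_vec_of_mat: "kron_row_left x Y *v vec_of_mat E = Y *v (E *v x)"
proof -
  have "(kron_row_left x Y *v vec_of_mat E) $ i = (Y *v (E *v x)) $ i" for i
    by (simp add: kron_row_left_def kron_def rowvector_def vec_of_mat_def matrix_vector_mult_def
        sum_UNIV_prod sum_distrib_left algebra_simps) (rule sum.swap)
  then show ?thesis by (simp add: vec_eq_iff)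
qed

lemma kron_row_right_mult_vec_of_mat:
  "kron_row_right X y *v vec_of_mat E = X *v (transpose E *v y)"
  by (simp add: kron_row_right_def kron_def rowvector_def vec_of_mat_def matrix_vector_mult_def
      transpose_def sum_UNIV_prod sum_distrib_left vec_eq_iff algebra_simps)

text \<open>Arranged to match \<open>kkt_solution\<close> with \<open>f = dd - F *v x\<close>,
  \<open>g = db - E *v x\<close> and \<open>h\<close> the negative of the last bracket, so that
  applying \<open>eils_MF\<close> becomes a solve of the augmented system.\<close>

lemma eils_MF_mult_vec_data:
  "eils_MF p A B b x *v vec_data E F db dd =
    eils_dcoef p A B *v (dd - F *v x) - eils_bcoef p A B *v (db - E *v x)
    - (matrix_inv (eils_M p A) ** eils_P p A B)
        *v (transpose E *v (sig_mat p *v eils_res A b x) + transpose F *v eils_mult p A B b x)"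
proof -
  have neg: "- X *v v = - (X *v v)" for X :: "real^'j^'i" and v
    using matrix_vector_mult_diff_rdistrib[of 0 X v] by simp
  show ?thesis
    by (simp add: eils_MF_def vec_data_def append_cols_mult_append_vec eils_Gamma_def eils_Omega_def
        neg matrix_vector_mult_diff_rdistrib matrix_vector_mult_add_rdistrib
        kron_row_left_mult_vec_of_mat kron_row_right_mult_vec_of_mat
        matrix_vector_mult_diff_distrib matrix_vector_right_distrib)
qed


section \<open>The augmented system\<close>

text \<open>Here \<open>D = (A, B)\<close> and \<open>w = (x, \<lambda>, r)\<close>.\<close>

definition kkt_coupling ::
    "nat \<Rightarrow> (real^'n, 'm) vec \<times> (real^'n^'s)
      \<Rightarrow> (real^'n) \<times> (real^'s) \<times> (real, 'm::{finite,linorder}) vec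
      \<Rightarrow> (real^'n) \<times> (real^'s) \<times> (real, 'm) vec"
  where "kkt_coupling p D w =
    (transpose (fst D) *v (sig_mat p *v snd (snd w)) + transpose (snd D) *v fst (snd w),
     snd D *v fst w, fst D *v fst w)"

text \<open>The summand bilinear in data and unknowns is kept apart from the fixed identity on
  \<open>r\<close>, since only the former changes with \<open>A\<close> and
  \<open>B\<close>.\<close>

definition kkt ::
    "nat \<Rightarrow> (real^'n, 'm) vec \<times> (real^'n^'s)
      \<Rightarrow> (real^'n) \<times> (real^'s) \<times> (real, 'm::{finite,linorder}) vec
      \<Rightarrow> (real^'n) \<times> (real^'s) \<times> (real, 'm) vec"
  where "kkt p D w = kkt_coupling p D w + (0, 0, snd (snd w))"

lemma bounded_bilinear_kkt_coupling: "bounded_bilinear (kkt_coupling p)"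
  unfolding bilinear_conv_bounded_bilinear[symmetric] bilinear_def kkt_coupling_def
  by (auto intro!: linearI simp: matrix_vector_mult_add_rdistrib matrix_vector_right_distrib
      matrix_vector_mult_scaleR scaleR_matrix_vector_assoc[symmetric] transpose_add transpose_scalar
      scaleR_add_right)

lemma linear_kkt: "linear (kkt p D)"
proof -
  interpret bounded_bilinear "kkt_coupling p" by (rule bounded_bilinear_kkt_coupling)
  show ?thesis
    by (rule linearI) (auto simp: kkt_def add_right scaleR_right scaleR_add_right)
qed

lemma kkt_add: "kkt p (D + D') w = kkt p D w + kkt_coupling p D' w"
proof -
  interpret bounded_bilinear "kkt_coupling p" by (rule bounded_bilinear_kkt_coupling)
  show ?thesis by (simp add: kkt_def add_left)
qed

section \<open>Solving the augmented system at admissible data\<close>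

context
  fixes p :: nat and A :: "real^'n^('m::{finite,linorder})" and B :: "real^'n^'s"
  assumes rank: "rank B = CARD('s)" and pd: "positive_definite (eils_M p A)"
begin

lemma invertible_eils_M: "invertible (eils_M p A)"
  and symmetric_eils_M: "transpose (eils_M p A) = eils_M p A"
  using pd positive_definite_invertible positive_definite_def by auto

lemma invertible_eils_N: "invertible (eils_N p A B)"
  and symmetric_eils_N: "transpose (eils_N p A B) = eils_N p A B"
  using positive_definite_eils_N[OF rank pd] positive_definite_invertible positive_definite_def
  by auto

lemmas eils_M_inverse =
  matrix_inv_invertible[OF invertible_eils_M]
  symmetric_matrix_inv[OF invertible_eils_M symmetric_eils_M]
lemmas eils_N_inverse =
  matrix_inv_invertible[OF invertible_eils_N]
  symmetric_matrix_inv[OF invertible_eils_N symmetric_eils_N]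

text \<open>By symmetry of \<open>M\<close> and \<open>N\<close>, both sides are
  \<open>M^-1 B^T N^-1 B M^-1 - M^-1\<close>. This reconciles the two forms in which
  \<open>P\<close> enters \<open>eils_MF\<close>.\<close>

lemma transpose_eils_P_mult_inverse:
  "transpose (eils_P p A B) ** matrix_inv (eils_M p A) = matrix_inv (eils_M p A) ** eils_P p A B"
proof -
  have "transpose (X - mat 1) = transpose X - mat 1" for X :: "real^'n^'n"
    by (simp add: transpose_def vec_eq_iff mat_def)
  moreover have "(X - Y) ** Z = X ** Z - Y ** Z" "Z ** (X - Y) = Z ** X - Z ** Y" for X Y Z :: "real^'n^'n"
    by (simp_all add: matrix_matrix_mult_def vec_eq_iff sum_subtractf algebra_simps)
  ultimately show ?thesis
    by (simp add: eils_P_def matrix_transpose_mul eils_M_inverse eils_N_inverse matrix_mul_assoc)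
qed

text \<open>Block elimination: the first and third rows give
  \<open>A^T J g = M x + h - B^T l\<close>. Applying \<open>M^-1 P\<close> removes \<open>l\<close>
  because \<open>P B^T = 0\<close>, and turns \<open>M x\<close> into
  \<open>M^-1 B^T N^-1 f - x\<close>.\<close>

lemma kkt_solution:
  assumes "kkt p (A, B) w = (h, f, g)"
  shows "fst w = eils_dcoef p A B *v f - eils_bcoef p A B *v g
    + (matrix_inv (eils_M p A) ** eils_P p A B) *v h"
proof -
  let ?Mi = "matrix_inv (eils_M p A)" and ?Ni = "matrix_inv (eils_N p A B)"
  obtain x l r where w: "w = (x, l, r)" by (cases w) auto
  have f: "f = B *v x" and g: "g = A *v x + r"
    and h: "h = transpose A *v (sig_mat p *v r) + transpose B *v l"
    using assms by (auto simp: kkt_def kkt_coupling_def w)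
  have inv_M_M: "?Mi *v (eils_M p A *v u) = u" and M_inv_M: "eils_M p A *v (?Mi *v u) = u" for u
    by (simp_all add: matrix_vector_mul_assoc eils_M_inverse)
  have "?Mi *v (transpose A *v (sig_mat p *v g)) = ?Mi *v (eils_M p A *v x) + ?Mi *v (h - transpose B *v l)"
    by (simp add: g h eils_M_def matrix_vector_right_distrib matrix_vector_mul_assoc[symmetric])
  then have Mg: "?Mi *v (transpose A *v (sig_mat p *v g)) = x + ?Mi *v (h - transpose B *v l)"
    by (simp only: inv_M_M)
  have P: "eils_P p A B *v u = transpose B *v (?Ni *v (B *v (?Mi *v u))) - u" for u
    by (simp add: eils_P_def matrix_vector_mult_diff_rdistrib matrix_vector_mul_assoc[symmetric])
  \<comment> \<open>Here \<open>B M^-1 B^T\<close> is \<open>N\<close>, so the first term of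
    \<open>P\<close> returns \<open>transpose B *v l\<close> unchanged and the second cancels
    it.\<close>
  have "?Ni *v (B *v (?Mi *v (transpose B *v l))) = (?Ni ** eils_N p A B) *v l"
    by (simp add: eils_N_def matrix_vector_mul_assoc matrix_mul_assoc)
  then have PB: "eils_P p A B *v (transpose B *v l) = 0"
    by (simp add: P eils_N_inverse)
  have "eils_bcoef p A B *v g = ?Mi *v (eils_P p A B *v (transpose A *v (sig_mat p *v g)))"
    by (simp add: eils_bcoef_def transpose_eils_P_mult_inverse matrix_vector_mul_assoc[symmetric])
  also have "\<dots> = ?Mi *v (eils_P p A B *v (eils_M p A *v (x + ?Mi *v (h - transpose B *v l))))"
    by (simp only: Mg[symmetric] M_inv_M)
  also have "\<dots> = ?Mi *v (eils_P p A B *v (eils_M p A *v x)) + ?Mi *v (eils_P p A B *v h)"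
    by (simp add: matrix_vector_right_distrib matrix_vector_mult_diff_distrib PB M_inv_M)
  also have "?Mi *v (eils_P p A B *v (eils_M p A *v x)) = eils_dcoef p A B *v f - x"
    by (simp add: P f inv_M_M eils_dcoef_def matrix_vector_mult_diff_distrib
        matrix_vector_mul_assoc[symmetric])
  finally show ?thesis
    by (simp add: w matrix_vector_mul_assoc)
qed

lemma full_row_rank_transpose_kernel: "transpose B *v l = 0 \<Longrightarrow> l = 0"
  using rank full_rank_injective[of "transpose B"]
  by (metis rank_transpose injD matrix_vector_mult_0_right)

text \<open>The solution formula forces \<open>x = 0\<close>; the third row then gives
  \<open>r = 0\<close>, and the first leaves \<open>B^T l = 0\<close>, where full row rank
  applies.\<close>

lemma inj_kkt: "inj (kkt p (A, B))"
proof (rule linear_injective_0[OF linear_kkt, THEN iffD2], intro allI impI)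
  fix w assume 0: "kkt p (A, B) w = 0"
  then have "fst w = 0"
    using kkt_solution[of w 0 0 0] by (simp add: zero_prod_def)
  then show "w = 0"
    using 0 full_row_rank_transpose_kernel[of "fst (snd w)"]
    by (auto simp: kkt_def kkt_coupling_def prod_eq_iff)
qed

lemma kkt_obtain:
  obtains w where "kkt p (A, B) w = z"
proof -
  have "surj (kkt p (A, B))"
    by (rule linear_injective_imp_surjective[OF linear_kkt inj_kkt]) (rule refl)
  from surjD[OF this, of z] show thesis
    using that by blast
qed

text \<open>With zero as first right-hand side, \<open>kkt_solution\<close> yields the closed form
  in \<open>is_eils_sol_iff\<close>.\<close>

lemma eils_sol_kkt:
  assumes "kkt p (A, B) w = (0, d, b)"
  shows "eils_sol p A B b d = fst w"
  using kkt_solution[OF assms] by (simp add: eils_sol_def is_eils_sol_iff[OF rank pd])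

lemma invertible_gram: "invertible (B ** transpose B)"
proof -
  have "l = 0" if "(B ** transpose B) *v l = 0" for l
  proof (rule full_row_rank_transpose_kernel)
    have "(transpose B *v l) \<bullet> (transpose B *v l) = l \<bullet> ((B ** transpose B) *v l)"
      by (simp add: adjoint_matrix matrix_vector_mul_assoc[symmetric])
    then show "transpose B *v l = 0" using that by simp
  qed
  then show ?thesis
    using matrix_left_invertible_ker invertible_left_inverse by blast
qed

text \<open>The system has some solution, and its first component must be the minimizer. The third
  row then identifies the residual, and \<open>B\<close> applied to the first row determines the
  multiplier through the Gram matrix \<open>B B^T\<close>.\<close>

lemma kkt_eils_sol:
  assumes "is_eils_sol p A B b d x"
  shows "kkt p (A, B) (x, eils_mult p A B b x, eils_res A b x) = (0, d, b)"
proof -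
  obtain w where w: "kkt p (A, B) w = (0, d, b)"
    by (rule kkt_obtain)
  have x: "fst w = x"
    using kkt_solution[OF w] assms by (simp add: is_eils_sol_iff[OF rank pd])
  define l r where "l = fst (snd w)" and "r = snd (snd w)"
  have r: "r = eils_res A b x"
    using w by (auto simp: r_def eils_res_def kkt_def kkt_coupling_def x)
  have "B *v (transpose A *v (sig_mat p *v r)) + (B ** transpose B) *v l = 0"
    using w by (auto simp: r_def l_def kkt_def kkt_coupling_def matrix_vector_mul_assoc[symmetric]
        matrix_vector_right_distrib[symmetric])
  then have "matrix_inv (B ** transpose B) *v ((B ** transpose B) *v l)
      = - (matrix_inv (B ** transpose B) *v (B *v (transpose A *v (sig_mat p *v r))))"
    by (metis add.commute add_eq_0_iff matrix_vector_mult_diff_distrib diff_0 matrix_vector_mult_0_right)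
  moreover have "matrix_inv (B ** transpose B) *v ((B ** transpose B) *v l) = l"
    by (simp only: matrix_vector_mul_assoc matrix_inv_invertible[OF invertible_gram] matrix_vector_mul_lid)
  ultimately have "l = eils_mult p A B b x"
    by (simp add: eils_mult_def r matrix_vector_mul_assoc[symmetric])
  with w x r show ?thesis
    by (metis l_def r_def prod.collapse)
qed

end

section \<open>First-order expansion of the solution\<close>

lemma norm_fst_pair_le: "norm (E, F) \<le> norm (E, F, G)"
proof -
  have "norm (E, F, G) = sqrt ((norm (E, F))\<^sup>2 + (norm G)\<^sup>2)"
    by (simp add: norm_Pair)
  then show ?thesis by simp
qed

text \<open>Three solves are compared: \<open>w\<close> for the given data, \<open>w'\<close> for
  the changed data, \<open>v\<close> for the linear response. The lower bound \<open>c\<close> on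
  the operator controls both \<open>w' - w\<close> and \<open>w' - w - v\<close>.\<close>

lemma eils_sol_taylor:
  fixes A :: "real^'n^('m::{finite,linorder})" and B :: "real^'n^'s"
  assumes rank: "rank B = CARD('s)" and pd: "positive_definite (eils_M p A)"
    and sol: "is_eils_sol p A B b d x"
  obtains C e where "e > 0" "C \<ge> 0"
    "\<And>E F db dd. norm (E, F, db, dd) < e \<Longrightarrow>
      norm (eils_sol p (A + E) (B + F) (b + db) (d + dd) - x - eils_MF p A B b x *v vec_data E F db dd)
        \<le> C * (norm (E, F, db, dd))\<^sup>2"
proof -
  define w where "w = (x, eils_mult p A B b x, eils_res A b x)"
  have w: "kkt p (A, B) w = (0, d, b)"
    using kkt_eils_sol[OF rank pd sol] by (simp add: w_def)
  obtain c where c: "c > 0" "\<And>v. c * norm v \<le> norm (kkt p (A, B) v)"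
    using linear_inj_bounded_below_pos[OF linear_kkt inj_kkt[OF rank pd]] by blast
  interpret G: bounded_bilinear "kkt_coupling p :: (real^'n, 'm) vec \<times> (real^'n^'s) \<Rightarrow> _"
    by (rule bounded_bilinear_kkt_coupling)
  obtain g where g: "g > 0" "\<And>D :: (real^'n, 'm) vec \<times> (real^'n^'s). \<And>v.
      norm (kkt_coupling p D v) \<le> norm D * norm v * g"
    using G.pos_bounded by blast
  obtain eA where eA: "eA > 0" "\<And>A'. dist A' A < eA \<Longrightarrow> positive_definite (eils_M p A')"
    using eventually_positive_definite_eils_M[OF pd] unfolding eventually_nhds_metric by blast
  obtain eB where eB: "eB > 0" "\<And>B' :: real^'n^'s. dist B' B < eB \<Longrightarrow> rank B' = CARD('s)"
    using eventually_full_row_rank[OF rank] unfolding eventually_nhds_metric by blast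
  \<comment> \<open>Lipschitz constant read off from the estimate
    \<open>(c / 2) * norm (w' - w) \<le> n + n * norm w * g\<close> below.\<close>
  define K where "K = 2 / c * (1 + norm w * g)"
  \<comment> \<open>The radii \<open>eA\<close> and \<open>eB\<close> keep the hypotheses valid for
    the changed data; below \<open>c / (2 * g)\<close> the coupling term costs at most half of
    \<open>c\<close> and can be absorbed on the left.\<close>
  define e where "e = min (min eA eB) (c / (2 * g))"
  have e: "e > 0" using eA eB c g by (simp add: e_def)
  have K: "K \<ge> 0" using c(1) g(1) by (simp add: K_def)
  have bound: "norm (eils_sol p (A + E) (B + F) (b + db) (d + dd) - x - eils_MF p A B b x *v vec_data E F db dd)
        \<le> g * K / c * (norm (E, F, db, dd))\<^sup>2"
    if small: "norm (E, F, db, dd) < e" for E F db dd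
  proof -
    define n where "n = norm (E, F, db, dd)"
    have nEF: "norm (E, F) \<le> n"
      using norm_fst_pair_le by (simp add: n_def)
    then have "norm E \<le> n" "norm F \<le> n"
      using norm_fst_le[of E F] norm_snd_le[of F E] by linarith+
    then have rank': "rank (B + F) = CARD('s)" and pd': "positive_definite (eils_M p (A + E))"
      using small by (auto intro!: eA(2) eB(2) simp: dist_norm e_def n_def)
    obtain w' where w': "kkt p (A + E, B + F) w' = (0, d + dd, b + db)"
      by (rule kkt_obtain[OF rank' pd'])
    define h :: "(real^'n) \<times> (real^'s) \<times> (real, 'm) vec" where "h = (0, dd, db)"
    have "norm (dd, db) \<le> norm (db, dd)"
      by (simp add: norm_Pair)
    also have "\<dots> \<le> norm (F, db, dd)" by (rule norm_snd_le)
    also have "\<dots> \<le> n" unfolding n_def by (rule norm_snd_le)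
    finally have h: "norm h \<le> n" by (simp add: h_def norm_Pair)
    have "kkt p (A, B) w' + kkt_coupling p (E, F) w' = kkt p (A, B) w + h"
      using w' kkt_add[of p "(A, B)" "(E, F)" w'] by (simp add: w h_def)
    then have diff: "kkt p (A, B) (w' - w) = h - kkt_coupling p (E, F) w'"
      by (simp add: linear_diff[OF linear_kkt] algebra_simps)
    have "c * norm (w' - w) \<le> norm h + norm (kkt_coupling p (E, F) w')"
      using order_trans[OF c(2)[of "w' - w", unfolded diff] norm_triangle_ineq4] .
    also have "norm (kkt_coupling p (E, F) w') \<le> n * norm w' * g"
      by (rule order_trans[OF g(2)]) (use nEF g(1) in \<open>intro mult_right_mono, auto\<close>)
    also have "n * norm w' * g \<le> n * (norm w + norm (w' - w)) * g"
      using norm_triangle_sub[of w' w] g(1) by (intro mult_right_mono mult_left_mono) (auto simp: n_def)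
    also have "\<dots> = n * norm w * g + (n * g) * norm (w' - w)"
      by (simp add: algebra_simps)
    also have "(n * g) * norm (w' - w) \<le> (c / 2) * norm (w' - w)"
      using small g(1) by (intro mult_right_mono) (auto simp: e_def n_def field_simps)
    finally have "(c / 2) * norm (w' - w) \<le> n + n * norm w * g"
      using h by simp
    then have lip: "norm (w' - w) \<le> K * n"
      using c(1) by (simp add: K_def field_simps)
    \<comment> \<open>Linear response: compared with \<open>diff\<close>, the unknown
      \<open>w'\<close> in the coupling is replaced by the known \<open>w\<close>.\<close>
    obtain v where v: "kkt p (A, B) v = h - kkt_coupling p (E, F) w"
      by (rule kkt_obtain[OF rank pd])
    define u where "u = transpose E *v (sig_mat p *v eils_res A b x) + transpose F *v eils_mult p A B b x"
    have "kkt p (A, B) v = (- u, dd - F *v x, db - E *v x)"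
      by (simp add: v h_def w_def kkt_coupling_def u_def)
    from kkt_solution[OF rank pd this]
    have MF: "fst v = eils_MF p A B b x *v vec_data E F db dd"
      using matrix_vector_mult_diff_distrib[of "matrix_inv (eils_M p A) ** eils_P p A B" 0 u]
      by (simp add: eils_MF_mult_vec_data u_def[symmetric])
    \<comment> \<open>The increment \<open>h\<close> cancels; what remains couples two first-order
      quantities and is therefore of second order.\<close>
    have "kkt p (A, B) (w' - w - v) = kkt p (A, B) (w' - w) - kkt p (A, B) v"
      by (rule linear_diff[OF linear_kkt])
    then have "kkt p (A, B) (w' - w - v) = - kkt_coupling p (E, F) (w' - w)"
      by (simp add: diff v G.diff_right)
    then have "c * norm (w' - w - v) \<le> norm (kkt_coupling p (E, F) (w' - w))"
      using c(2)[of "w' - w - v"] by simp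
    also have "\<dots> \<le> norm (E, F) * norm (w' - w) * g" by (rule g(2))
    also have "\<dots> \<le> n * (K * n) * g"
      using nEF lip g(1) by (intro mult_right_mono mult_mono) (auto simp: n_def)
    finally have "norm (w' - w - v) \<le> g * K / c * n\<^sup>2"
      using c(1) by (simp add: field_simps power2_eq_square)
    moreover have "norm (fst (w' - w - v)) \<le> norm (w' - w - v)"
      using norm_fst_le[of "fst (w' - w - v)" "snd (w' - w - v)"] by (simp only: prod.collapse)
    moreover have "fst (w' - w - v) = eils_sol p (A + E) (B + F) (b + db) (d + dd) - x
        - eils_MF p A B b x *v vec_data E F db dd"
      by (simp add: eils_sol_kkt[OF rank' pd' w'] MF w_def)
    ultimately show ?thesis by (simp add: n_def)
  qed
  show thesis
    by (rule that[OF e _ bound]) (use c(1) g(1) K in auto)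
qed

section \<open>Condition numbers\<close>

text \<open>Here \<open>N\<close> is the size of a data change, \<open>R\<close> the true and
  \<open>S\<close> the linearized output change. For small \<open>\<delta>\<close> the supremum is
  squeezed between \<open>\<kappa> - C * \<delta>\<close> and
  \<open>\<kappa> + \<bar>C\<bar> * \<delta>\<close>.\<close>

lemma Lim_condition_number:
  fixes N R S :: "'a \<Rightarrow> real"
  assumes e: "e > 0"
    and approx: "\<And>t. N t < e \<Longrightarrow> \<bar>R t - S t\<bar> \<le> C * (N t)\<^sup>2"
    and upper: "\<And>t. S t \<le> \<kappa> * N t"
    and attained: "\<And>s. s > 0 \<Longrightarrow> \<exists>t. N t = s \<and> S t = \<kappa> * s"
  shows "Lim (at_right 0) (\<lambda>\<delta>. Sup {ereal (R t / N t) | t. 0 < N t \<and> N t \<le> \<delta>}) = ereal \<kappa>"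
proof (rule tendsto_Lim)
  let ?Q = "\<lambda>\<delta>. Sup {ereal (R t / N t) | t. 0 < N t \<and> N t \<le> \<delta>}"
  have ev: "\<forall>\<^sub>F \<delta> in at_right 0. 0 < \<delta> \<and> \<delta> < e"
    using e by (auto simp: eventually_at_right_field)
  have R: "\<kappa> - C * s \<le> R t / s" if "N t = s" "S t = \<kappa> * s" "0 < s" "s < e" for t s
    using approx[of t] that by (simp add: field_simps power2_eq_square abs_le_iff)
  \<comment> \<open>A change of size exactly \<open>\<delta>\<close> attaining the linear bound
    already reaches this estimate.\<close>
  have lo: "\<forall>\<^sub>F \<delta> in at_right 0. ereal (\<kappa> - C * \<delta>) \<le> ?Q \<delta>"
    using ev
  proof eventually_elim
    case (elim \<delta>)
    then obtain t where t: "N t = \<delta>" "S t = \<kappa> * \<delta>" using attained by blast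
    then have "ereal (\<kappa> - C * \<delta>) \<le> ereal (R t / N t)"
      using R[OF t] elim by simp
    also have "\<dots> \<le> ?Q \<delta>"
      using t elim by (intro Sup_upper CollectI exI[of _ t] conjI) auto
    finally show ?case .
  qed
  have hi: "\<forall>\<^sub>F \<delta> in at_right 0. ?Q \<delta> \<le> ereal (\<kappa> + \<bar>C\<bar> * \<delta>)"
    using ev
  proof eventually_elim
    case (elim \<delta>)
    have "R t / N t \<le> \<kappa> + \<bar>C\<bar> * \<delta>" if "0 < N t" "N t \<le> \<delta>" for t
    proof -
      have "R t \<le> \<kappa> * N t + C * (N t)\<^sup>2"
        using approx[of t] upper[of t] that elim by linarith
      then have "R t / N t \<le> \<kappa> + C * N t"
        using that by (simp add: field_simps power2_eq_square)
      also have "C * N t \<le> \<bar>C\<bar> * \<delta>"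
        using that by (intro mult_mono) auto
      finally show ?thesis by simp
    qed
    then show ?case
      by (intro Sup_least) auto
  qed
  have "((\<lambda>\<delta>. \<kappa> - C * \<delta>) \<longlongrightarrow> \<kappa> - C * 0) (at_right 0)"
    by (intro tendsto_intros)
  then have 1: "((\<lambda>\<delta>. ereal (\<kappa> - C * \<delta>)) \<longlongrightarrow> ereal \<kappa>) (at_right 0)"
    by simp
  have "((\<lambda>\<delta>. \<kappa> + \<bar>C\<bar> * \<delta>) \<longlongrightarrow> \<kappa> + \<bar>C\<bar> * 0) (at_right 0)"
    by (intro tendsto_intros)
  then have 2: "((\<lambda>\<delta>. ereal (\<kappa> + \<bar>C\<bar> * \<delta>)) \<longlongrightarrow> ereal \<kappa>) (at_right 0)"
    by simp
  show "(?Q \<longlongrightarrow> ereal \<kappa>) (at_right 0)"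
    by (rule tendsto_sandwich[OF lo hi 1 2])
qed simp

section \<open>Max norm of stacked data\<close>

lemma infnorm_vec: "infnorm (v :: real^'n) = Max (range (\<lambda>i. \<bar>v $ i\<bar>))"
proof -
  have "(\<lambda>u. \<bar>v \<bullet> u\<bar>) ` Basis = range (\<lambda>i. \<bar>v $ i\<bar>)"
    by (force simp: Basis_vec_def inner_axis)
  then show ?thesis by (simp add: infnorm_Max)
qed

lemma infnorm_vec_le_iff: "infnorm (v :: real^'n) \<le> c \<longleftrightarrow> (\<forall>i. \<bar>v $ i\<bar> \<le> c)"
  by (simp add: infnorm_vec)

lemma infnorm_matrix_le_iff: "infnorm (A :: real^'n^'m) \<le> c \<longleftrightarrow> (\<forall>i j. \<bar>A $ i $ j\<bar> \<le> c)"
  by (simp add: infnorm_matrix)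

lemma infnorm_append_vec: "infnorm (append_vec u v) = max (infnorm u) (infnorm v)"
proof -
  have "infnorm (append_vec u v) \<le> c \<longleftrightarrow> max (infnorm u) (infnorm v) \<le> c" for c
    by (simp add: infnorm_vec_le_iff append_vec_def split_sum_all)
  then show ?thesis by (meson order_antisym order_refl)
qed

lemma infnorm_vec_of_mat: "infnorm (vec_of_mat A) = infnorm A"
proof -
  have "infnorm (vec_of_mat A) \<le> c \<longleftrightarrow> infnorm A \<le> c" for c
    by (auto simp: infnorm_vec_le_iff infnorm_matrix_le_iff vec_of_mat_def)
  then show ?thesis by (meson order_antisym order_refl)
qed

text \<open>The condition number measures data by blocks while \<open>eils_MF\<close> acts on the
  stacked vector; this makes the two sizes interchangeable.\<close>

lemma infnorm_vec_data: "infnorm (vec_data A B b d) = infnorm (A, B, b, d)"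
  by (simp add: vec_data_def infnorm_append_vec infnorm_vec_of_mat infnorm_Pair)

lemma vec_data_mult:
  "vec_data (A * A') (B * B') (b * b') (d * d') = vec_data A B b d * vec_data A' B' b' d'"
  by (simp add: vec_data_def append_vec_def vec_of_mat_def vec_eq_iff split: sum.split)

lemma surj_append_vec: obtains u v where "w = append_vec u v"
proof
  show "w = append_vec (\<chi> i. w $ Inl i) (\<chi> j. w $ Inr j)"
    by (simp add: append_vec_def vec_eq_iff split: sum.split)
qed

lemma surj_vec_of_mat: obtains A where "w = vec_of_mat A"
proof
  show "w = vec_of_mat (\<chi> i j. w $ (j, i))"
    by (simp add: vec_of_mat_def vec_eq_iff)
qed

text \<open>Needed to realize an extremal stacked vector as an actual data change.\<close>

lemma surj_vec_data: obtains A B b d where "w = vec_data A B b d"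
  unfolding vec_data_def by (metis surj_append_vec surj_vec_of_mat)

lemma vec_data_nonzero:
  assumes "\<forall>i j. A $ i $ j \<noteq> 0" "\<forall>i j. B $ i $ j \<noteq> 0" "\<forall>i. b $ i \<noteq> 0" "\<forall>i. d $ i \<noteq> 0"
  shows "vec_data A B b d $ k \<noteq> 0"
  using assms by (auto simp: vec_data_def append_vec_def vec_of_mat_def split: sum.split)

section \<open>Diagonal scalings, output weights and the row-sum norm\<close>

lemma diag_mat_mult_vec: "(diag_mat w *v v) = w * v"
  by (simp add: diag_mat_def matrix_vector_mult_def vec_eq_iff if_distrib[of "\<lambda>x. x * _"] cong: if_cong)

lemma diag_mat_mult_nth: "(diag_mat w ** X) $ i $ j = w $ i * X $ i $ j"
  by (simp add: diag_mat_def matrix_matrix_mult_def if_distrib[of "\<lambda>x. x * _"] cong: if_cong)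

lemma mult_diag_mat_nth: "(X ** diag_mat w) $ i $ j = X $ i $ j * w $ j"
  by (simp add: diag_mat_def matrix_matrix_mult_def if_distrib[of "\<lambda>x. _ * x"] cong: if_cong)

text \<open>A scalar weight becomes a constant vector, so both kinds of weight act as one diagonal
  row scaling.\<close>

fun weight_coeffs :: "('k::finite) weight \<Rightarrow> real^'k" where
  "weight_coeffs (Vec_Weight w) = w"
| "weight_coeffs (Scalar_Weight c) = (\<chi> i. c)"

lemma weight_vec_eq: "weight_vec \<xi> v = weight_coeffs \<xi> * v"
  by (cases \<xi>) (simp_all add: diag_mat_mult_vec vec_eq_iff)

lemma weight_mat_eq: "weight_mat \<xi> X = diag_mat (weight_coeffs \<xi>) ** X"
  by (cases \<xi>) (simp_all add: vec_eq_iff diag_mat_mult_nth)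

lemma abs_vec_nth: "\<bar>v\<bar> $ i = \<bar>v $ i\<bar>"
  by (simp add: abs_vec_def)

lemma weight_coeffs_abs: "weight_coeffs (abs_weight \<xi>) = \<bar>weight_coeffs \<xi>\<bar>"
  by (cases \<xi>) (simp_all add: vec_eq_iff abs_vec_nth)

lemma weight_mat_mult_vec: "weight_mat \<xi> X *v v = weight_vec \<xi> (X *v v)"
  by (simp add: weight_mat_eq weight_vec_eq diag_mat_mult_vec flip: matrix_vector_mul_assoc)

lemma linear_weight_vec: "linear (weight_vec \<xi>)"
  by (rule linearI) (simp_all add: weight_vec_eq vec_eq_iff algebra_simps)

text \<open>The weight scales rows and \<open>diag_mat w\<close> scales columns, so absolute values
  factor entrywise in each row sum; the results are nonnegative, as the outer absolute value
  requires. This is the second equality of the theorem.\<close>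

lemma mat_infnorm_weighted:
  "mat_infnorm (weight_mat \<xi> (Y ** diag_mat w)) = infnorm (weight_vec (abs_weight \<xi>) (\<bar>Y\<bar> *v \<bar>w\<bar>))"
proof -
  have "(\<Sum>j\<in>UNIV. \<bar>weight_mat \<xi> (Y ** diag_mat w) $ i $ j\<bar>)
      = \<bar>weight_vec (abs_weight \<xi>) (\<bar>Y\<bar> *v \<bar>w\<bar>) $ i\<bar>" for i
    by (simp add: weight_mat_eq weight_vec_eq weight_coeffs_abs diag_mat_mult_nth mult_diag_mat_nth
        matrix_vector_mult_def abs_mult abs_vec_nth sum_nonneg sum_distrib_left)
  then show ?thesis
    by (simp add: mat_infnorm_def infnorm_vec)
qed

lemma infnorm_mult_vec_le: "infnorm (X *v y) \<le> mat_infnorm X * infnorm y"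
proof -
  have "\<bar>(X *v y) $ i\<bar> \<le> mat_infnorm X * infnorm y" for i
  proof -
    have "\<bar>(X *v y) $ i\<bar> \<le> (\<Sum>j\<in>UNIV. \<bar>X $ i $ j\<bar> * \<bar>y $ j\<bar>)"
      by (simp add: matrix_vector_mult_def sum_abs[THEN order_trans] abs_mult)
    also have "\<dots> \<le> (\<Sum>j\<in>UNIV. \<bar>X $ i $ j\<bar>) * infnorm y"
      by (simp add: sum_distrib_right sum_mono mult_left_mono component_le_infnorm_cart)
    also have "\<dots> \<le> mat_infnorm X * infnorm y"
      by (simp add: mat_infnorm_def mult_right_mono infnorm_pos_le)
    finally show ?thesis .
  qed
  then show ?thesis by (simp add: infnorm_vec_le_iff)
qed

text \<open>Tested on the sign pattern of a row with largest absolute sum, the corresponding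
  coordinate of the product is that whole sum.\<close>

lemma mat_infnorm_attained:
  fixes X :: "real^'n^'m"
  obtains y :: "real^'n" where "infnorm y = 1" "infnorm (X *v y) = mat_infnorm X"
proof -
  have "mat_infnorm X \<in> range (\<lambda>i. \<Sum>j\<in>UNIV. \<bar>X $ i $ j\<bar>)"
    unfolding mat_infnorm_def by (intro Max_in) auto
  then obtain i where i: "mat_infnorm X = (\<Sum>j\<in>UNIV. \<bar>X $ i $ j\<bar>)" by auto
  \<comment> \<open>Zero entries receive the value 1, so every coordinate of \<open>y\<close> has
    absolute value 1.\<close>
  define y :: "real^'n" where "y = (\<chi> j. if X $ i $ j < 0 then - 1 else 1)"
  have y: "infnorm y = 1"
  proof -
    have "range (\<lambda>j. \<bar>y $ j\<bar>) = {1}" by (auto simp: y_def)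
    then show ?thesis by (simp add: infnorm_vec)
  qed
  have "(X *v y) $ i = mat_infnorm X"
    unfolding i matrix_vector_mult_def by (simp add: y_def) (rule sum.cong, auto)
  then have "mat_infnorm X \<le> infnorm (X *v y)"
    using component_le_infnorm_cart[of "X *v y" i] by simp
  then show thesis
    using that[OF y] infnorm_mult_vec_le[of X y] y by simp
qed

lemma abs_infnorm_diff_le: "\<bar>infnorm u - infnorm v\<bar> \<le> norm (u - v)"
  using absdiff_infnorm[of u v] infnorm_le_norm[of "u - v"] by linarith

text \<open>Nonzero weights make the entrywise scaling injective, hence bounded below; passing from
  Euclidean to max norm costs the root of the dimension. This converts the Taylor error to the
  weighted size.\<close>

lemma weighted_data_norm_bound:
  fixes \<Phi> :: "real^'n^'m" and \<Psi> :: "real^'n^'s" and \<beta> :: "real^'m" and \<theta> :: "real^'s"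
  assumes nz: "\<forall>i j. \<Phi> $ i $ j \<noteq> 0" "\<forall>i j. \<Psi> $ i $ j \<noteq> 0" "\<forall>i. \<beta> $ i \<noteq> 0" "\<forall>i. \<theta> $ i \<noteq> 0"
  obtains K where "K > 0"
    "\<And>dA dB db dd. norm (dA, dB, db, dd) \<le> K * infnorm (\<Phi> * dA, \<Psi> * dB, \<beta> * db, \<theta> * dd)"
proof -
  let ?f = "\<lambda>(dA, dB, db, dd). (\<Phi> * dA, \<Psi> * dB, \<beta> * db, \<theta> * dd)"
  have lin: "linear ?f"
    by (rule linearI) (auto simp: vec_eq_iff algebra_simps)
  have "inj ?f"
    unfolding linear_injective_0[OF lin]
    using nz by (auto simp: zero_prod_def vec_eq_iff)
  then obtain c where c: "c > 0" "\<And>t. c * norm t \<le> norm (?f t)"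
    using linear_inj_bounded_below_pos[OF lin] by blast
  define a where "a = sqrt DIM((real^'n^'m) \<times> (real^'n^'s) \<times> (real^'m) \<times> (real^'s))"
  have a: "a > 0" unfolding a_def by (simp only: real_sqrt_gt_0_iff of_nat_0_less_iff DIM_positive)
  show thesis
  proof (rule that[of "a / c"])
    show "a / c > 0" using a c(1) by simp
    show "norm (dA, dB, db, dd) \<le> a / c * infnorm (\<Phi> * dA, \<Psi> * dB, \<beta> * db, \<theta> * dd)" for dA dB db dd
      using order_trans[OF c(2)[of "(dA, dB, db, dd)"] norm_le_infnorm] c(1)
      by (simp add: a_def field_simps)
  qed
qed

text \<open>In terms of the weighted data change \<open>y\<close>, the linearized quotient is
  \<open>infnorm (Z *v y) / infnorm y\<close>, whose largest value is the row-sum norm of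
  \<open>Z\<close>; \<open>Lim_condition_number\<close> transfers this to the true quotient.\<close>

lemma proj_cond_eq:
  fixes A :: "real^'n^('m::{finite,linorder})" and B :: "real^'n^'s"
    and L :: "real^'k^'n" and \<xi> :: "'k weight"
  assumes rank: "rank B = CARD('s)" and pd: "positive_definite (eils_M p A)"
    and sol: "is_eils_sol p A B b d x"
    and nz: "\<forall>i j. \<Phi> $ i $ j \<noteq> 0" "\<forall>i j. \<Psi> $ i $ j \<noteq> 0" "\<forall>i. \<beta> $ i \<noteq> 0" "\<forall>i. \<theta> $ i \<noteq> 0"
  shows "proj_cond p L \<xi> \<Phi> \<Psi> \<beta> \<theta> A B b d
    = ereal (mat_infnorm (weight_mat \<xi>
        (transpose L ** eils_MF p A B b x ** diag_mat (ddag_vec (vec_data \<Phi> \<Psi> \<beta> \<theta>)))))"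
proof -
  define \<rho> where "\<rho> = vec_data \<Phi> \<Psi> \<beta> \<theta>"
  define Z where "Z = weight_mat \<xi> (transpose L ** eils_MF p A B b x ** diag_mat (ddag_vec \<rho>))"
  define W where "W = (\<lambda>v. weight_vec \<xi> (transpose L *v v))"
  define N where "N = (\<lambda>(dA, dB, db, dd). infnorm (\<Phi> * dA, \<Psi> * dB, \<beta> * db, \<theta> * dd))"
  define R where "R = (\<lambda>(dA, dB, db, dd). infnorm (weight_vec \<xi>
    (proj_sol p L (A + dA) (B + dB) (b + db) (d + dd) - proj_sol p L A B b d)))"
  define S where "S = (\<lambda>(dA, dB, db, dd). infnorm (W (eils_MF p A B b x *v vec_data dA dB db dd)))"
  have "linear W"
    using linear_compose[OF matrix_vector_mul_linear[of "transpose L"] linear_weight_vec[of \<xi>]]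
    by (simp only: W_def o_def)
  obtain w where w: "w > 0" "\<And>v. norm (W v) \<le> w * norm v"
    by (rule linear_bounded_pos[OF \<open>linear W\<close>]) (rule that)
  obtain C e where e: "e > 0" and C: "C \<ge> 0" and taylor: "\<And>E F db dd. norm (E, F, db, dd) < e \<Longrightarrow>
      norm (eils_sol p (A + E) (B + F) (b + db) (d + dd) - x - eils_MF p A B b x *v vec_data E F db dd)
        \<le> C * (norm (E, F, db, dd))\<^sup>2"
    by (rule eils_sol_taylor[OF rank pd sol]) (rule that)
  obtain K where K: "K > 0"
      "\<And>dA dB db dd. norm (dA, dB, db, dd) \<le> K * infnorm (\<Phi> * dA, \<Psi> * dB, \<beta> * db, \<theta> * dd)"
    by (rule weighted_data_norm_bound[OF nz]) (rule that)
  have x: "eils_sol p A B b d = x"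
    using sol by (simp add: eils_sol_def is_eils_sol_iff[OF rank pd])
  have \<rho>: "\<rho> $ k \<noteq> 0" for k
    using vec_data_nonzero[OF nz] by (simp add: \<rho>_def)
  \<comment> \<open>The factor \<open>ddag_vec \<rho>\<close> inside \<open>Z\<close> undoes the
    data weights, since no entry of \<open>\<rho>\<close> vanishes.\<close>
  have S: "S (dA, dB, db, dd) = infnorm (Z *v vec_data (\<Phi> * dA) (\<Psi> * dB) (\<beta> * db) (\<theta> * dd))" for dA dB db dd
  proof -
    have "ddag_vec \<rho> * (\<rho> * v) = v" for v
      using \<rho> by (simp add: vec_eq_iff ddag_vec_def ddag_def)
    then show ?thesis
      by (simp add: S_def W_def Z_def weight_mat_mult_vec vec_data_mult diag_mat_mult_vec
          flip: matrix_vector_mul_assoc \<rho>_def)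
  qed
  \<comment> \<open>The radius \<open>e / K\<close> and the factor \<open>K\<^sup>2\<close> come
    from passing to the weighted size; \<open>w\<close> bounds the projected and weighted output
    map.\<close>
  have approx: "\<bar>R t - S t\<bar> \<le> w * C * K\<^sup>2 * (N t)\<^sup>2" if "N t < e / K" for t
  proof -
    obtain dA dB db dd where t: "t = (dA, dB, db, dd)" by (cases t) auto
    define y where "y = eils_sol p (A + dA) (B + dB) (b + db) (d + dd)"
    have n: "norm t \<le> K * N t" using K(2) by (simp add: t N_def)
    also have "\<dots> < e" using that K(1) by (simp add: field_simps)
    finally have "norm (y - x - eils_MF p A B b x *v vec_data dA dB db dd) \<le> C * (norm t)\<^sup>2"
      using taylor unfolding t y_def by blast
    also have "\<dots> \<le> C * (K * N t)\<^sup>2"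
      using n C by (intro mult_left_mono power_mono) auto
    finally have le: "norm (y - x - eils_MF p A B b x *v vec_data dA dB db dd) \<le> C * (K * N t)\<^sup>2" .
    have "R t = infnorm (W (y - x))"
      by (simp only: t R_def W_def y_def prod.case proj_sol_def x matrix_vector_mult_diff_distrib)
    then have "\<bar>R t - S t\<bar> \<le> norm (W (y - x) - W (eils_MF p A B b x *v vec_data dA dB db dd))"
      by (simp only: t S_def prod.case abs_infnorm_diff_le)
    also have "\<dots> = norm (W (y - x - eils_MF p A B b x *v vec_data dA dB db dd))"
      by (simp only: linear_diff[OF \<open>linear W\<close>])
    also have "\<dots> \<le> w * (C * (K * N t)\<^sup>2)"
      by (rule order_trans[OF w(2)]) (use le w(1) in simp)
    finally show ?thesis by (simp add: power_mult_distrib)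
  qed
  have upper: "S t \<le> mat_infnorm Z * N t" for t
    using infnorm_mult_vec_le by (cases t) (simp add: S N_def flip: infnorm_vec_data)
  have attained: "\<exists>t. N t = s \<and> S t = mat_infnorm Z * s" if "s > 0" for s
  proof -
    obtain y where y: "infnorm y = 1" "infnorm (Z *v y) = mat_infnorm Z"
      by (rule mat_infnorm_attained)
    \<comment> \<open>Division by \<open>\<rho>\<close> is chosen so that the weighted change is
      \<open>s *\<^sub>R y\<close>, of size exactly \<open>s\<close>.\<close>
    obtain dA dB db dd where v: "(\<chi> k. s * y $ k / \<rho> $ k) = vec_data dA dB db dd"
      by (rule surj_vec_data)
    have "\<rho> * vec_data dA dB db dd = s *\<^sub>R y"
      unfolding v[symmetric] using \<rho> by (simp add: vec_eq_iff)
    then have v': "vec_data (\<Phi> * dA) (\<Psi> * dB) (\<beta> * db) (\<theta> * dd) = s *\<^sub>R y"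
      by (simp add: vec_data_mult \<rho>_def)
    have "N (dA, dB, db, dd) = s"
      using that y(1) by (simp add: N_def v' infnorm_mul flip: infnorm_vec_data)
    moreover have "S (dA, dB, db, dd) = mat_infnorm Z * s"
      using that y(2) by (simp add: S v' infnorm_mul matrix_vector_mult_scaleR)
    ultimately show ?thesis by blast
  qed
  have "proj_cond p L \<xi> \<Phi> \<Psi> \<beta> \<theta> A B b d
      = Lim (at_right 0) (\<lambda>\<delta>. Sup {ereal (R t / N t) | t. 0 < N t \<and> N t \<le> \<delta>})"
    unfolding proj_cond_def R_def N_def by (simp only: split_paired_Ex prod.case)
  also have "\<dots> = ereal (mat_infnorm Z)"
    by (rule Lim_condition_number[OF _ approx upper attained]) (use e K in simp_all)
  finally show ?thesis by (simp only: Z_def \<rho>_def)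
qed

section \<open>Mixed and componentwise condition numbers\<close>

lemma ddag_nonzero: "ddag c \<noteq> 0"
  by (simp add: ddag_def)

text \<open>Reconciles the absolute value of the weight \<open>ddag_vec (L^T x)\<close> with the
  divisor \<open>\<bar>L^T x\<bar>\<close> in \<open>vec_divide\<close>.\<close>

lemma abs_ddag_vec: "\<bar>ddag_vec v\<bar> = ddag_vec \<bar>v\<bar>"
  by (simp add: vec_eq_iff ddag_vec_def ddag_def abs_vec_nth)

theorem theorem3p5:
  fixes A :: "real^'n^('m::{finite,linorder})" and B :: "real^'n^'s"
    and b :: "(real, 'm) vec" and d :: "real^'s"
    and L :: "real^'k^'n" and x :: "real^'n" and p q :: nat
  assumes "p + q = CARD('m)"
    and "rank B = CARD('s)"
    and "positive_definite (transpose A ** sig_mat p ** A)"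
    and "is_eils_sol p A B b d x"
    and "rank L = CARD('k)"
  shows "(\<forall>(\<xi> :: 'k weight) (\<Phi> :: (real^'n, 'm) vec) (\<Psi> :: real^'n^'s) (\<beta> :: (real, 'm) vec) (\<theta> :: real^'s).
            admissible_weight \<xi> \<and> (\<forall>i j. \<Phi> $ i $ j \<noteq> 0) \<and> (\<forall>i j. \<Psi> $ i $ j \<noteq> 0)
              \<and> (\<forall>i. \<beta> $ i \<noteq> 0) \<and> (\<forall>i. \<theta> $ i \<noteq> 0) \<longrightarrow>
            proj_cond p L \<xi> \<Phi> \<Psi> \<beta> \<theta> A B b d
              = ereal (mat_infnorm (weight_mat \<xi>
                  (transpose L ** eils_MF p A B b x ** diag_mat (ddag_vec (vec_data \<Phi> \<Psi> \<beta> \<theta>)))))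
            \<and> mat_infnorm (weight_mat \<xi>
                  (transpose L ** eils_MF p A B b x ** diag_mat (ddag_vec (vec_data \<Phi> \<Psi> \<beta> \<theta>))))
              = infnorm (weight_vec (abs_weight \<xi>)
                  (\<bar>transpose L ** eils_MF p A B b x\<bar> *v \<bar>ddag_vec (vec_data \<Phi> \<Psi> \<beta> \<theta>)\<bar>)))
    \<and> (transpose L *v x \<noteq> 0 \<longrightarrow>
         proj_mixed_cond p L A B b d
           = ereal (infnorm (\<bar>transpose L ** eils_MF p A B b x\<bar>
                 *v \<bar>ddag_vec (vec_data (ddag_mat A) (ddag_mat B) (ddag_vec b) (ddag_vec d))\<bar>)
               / infnorm (transpose L *v x)))
    \<and> proj_comp_cond p L A B b d
        = ereal (infnorm (vec_divide
            (\<bar>transpose L ** eils_MF p A B b x\<bar>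
               *v \<bar>ddag_vec (vec_data (ddag_mat A) (ddag_mat B) (ddag_vec b) (ddag_vec d))\<bar>)
            \<bar>transpose L *v x\<bar>))"
proof -
  note rank = assms(2) and sol = assms(4)
  have pd: "positive_definite (eils_M p A)"
    using assms(3) by (simp only: eils_M_def)
  have Lx: "proj_sol p L A B b d = transpose L *v x"
    using sol by (simp add: proj_sol_def eils_sol_def is_eils_sol_iff[OF rank pd])
  note cond = proj_cond_eq[OF rank pd sol, of _ _ _ _ L]
  \<comment> \<open>Values of \<open>ddag\<close> never vanish, so the general formula applies even
    where the data have zero entries.\<close>
  have data: "proj_cond p L \<xi> (ddag_mat A) (ddag_mat B) (ddag_vec b) (ddag_vec d) A B b d
      = ereal (infnorm (weight_vec (abs_weight \<xi>) (\<bar>transpose L ** eils_MF p A B b x\<bar>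
          *v \<bar>ddag_vec (vec_data (ddag_mat A) (ddag_mat B) (ddag_vec b) (ddag_vec d))\<bar>)))" for \<xi>
    unfolding mat_infnorm_weighted[symmetric]
    by (rule cond) (simp_all add: ddag_mat_def ddag_vec_def ddag_nonzero)
  show ?thesis
  proof (intro conjI allI impI)
    show "proj_mixed_cond p L A B b d
        = ereal (infnorm (\<bar>transpose L ** eils_MF p A B b x\<bar>
              *v \<bar>ddag_vec (vec_data (ddag_mat A) (ddag_mat B) (ddag_vec b) (ddag_vec d))\<bar>)
            / infnorm (transpose L *v x))"
      unfolding proj_mixed_cond_def data Lx
      by (simp add: infnorm_mul infnorm_pos_le)
    show "proj_comp_cond p L A B b d
        = ereal (infnorm (vec_divide
            (\<bar>transpose L ** eils_MF p A B b x\<bar>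
               *v \<bar>ddag_vec (vec_data (ddag_mat A) (ddag_mat B) (ddag_vec b) (ddag_vec d))\<bar>)
            \<bar>transpose L *v x\<bar>))"
      unfolding proj_comp_cond_def data Lx
      by (simp only: abs_weight.simps weight_vec.simps vec_divide_def abs_ddag_vec)
  qed (use cond in \<open>auto simp only: mat_infnorm_weighted\<close>)
qed

end
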